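(* Let $\mathcal{H}:\mathbb{R}^{2n}\to\mathbb{R}$ be proper, closed, convex and continuously differentiable, with a unique minimizer $z_\star$ and $\mathcal{H}(z)\ge\mathcal{H}(z_\star)=0$ for all $z$. Let $M\in\mathbb{R}^{2n\times 2n}$ be a nonsingular matrix satisfying $MJM^T=J$, and define $\bar{\mathcal{H}}(y)=\mathcal{H}(M^{-1}y)$ and $y_\star=Mz_\star$. If $y_t$, $t\ge0$, is a solution of $$\dot y_t=J\nabla\bar{\mathcal{H}}(y_t)+y_\star-y_t,$$ then $z_t:=M^{-1}y_t$ is the solution, with initial point $z_0=M^{-1}y_0$, of $$\dot z_t=J\nabla\mathcal{H}(z_t)+z_\star-z_t,$$ in the sense that it satisfies this equation for all $t\ge 0$; that is, $y_t=Mz_t$ for all $t$, and $\bar{\mathcal{H}}(y_t)=\mathcal{H}(z_t)$ for all $t\ge0$.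
   Context: $J=\begin{bmatrix}0&I\\-I&0\end{bmatrix}\in\mathbb{R}^{2n\times2n}$, where $I$ is the $n\times n$ identity matrix. Solutions of the ODEs are differentiable curves defined for all $t\ge0$. *)

theory Defs
  imports "HOL-Analysis.Analysis"
begin

(* R^(2n) is real ^ ('n + 'n) with CARD('n) = n: the Inl coordinates are the first n
   ones and the Inr coordinates the last n. *)

definition symp_J :: "real ^ ('n::finite + 'n) ^ ('n + 'n)" where
  "symp_J = (\<chi> r c. case (r, c) of
      (Inl i, Inr j) \<Rightarrow> (if i = j then 1 else 0)
    | (Inr i, Inl j) \<Rightarrow> (if i = j then - 1 else 0)
    | _ \<Rightarrow> 0)"

definition gradient :: "('a::real_inner \<Rightarrow> real) \<Rightarrow> 'a \<Rightarrow> 'a" where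
  "gradient f x = (THE D. GDERIV f x :> D)"

(* The definite description denotes the gradient wherever f is differentiable. *)
lemma gradient_eqI:
  assumes "GDERIV f x :> D"
  shows "gradient f x = D"
proof -
  have "D' = D" if "GDERIV f x :> D'" for D'
  proof -
    have "(\<lambda>h. inner h D') = (\<lambda>h. inner h D)"
      using that assms has_derivative_unique unfolding gderiv_def by blast
    then have "\<forall>h. inner h D' = inner h D"
      by (simp add: fun_eq_iff)
    then show ?thesis
      by (simp only: vector_eq_ldot)
  qed
  with assms show ?thesis
    unfolding gradient_def by (blast intro: the_equality)
qed

lemma gderiv_gradient:
  fixes f :: "'a::euclidean_space \<Rightarrow> real"
  assumes "f differentiable (at x)"
  shows "GDERIV f x :> gradient f x"
proof -
  obtain f' where f': "(f has_derivative f') (at x)"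
    using assms unfolding differentiable_def by blast
  then have lin: "linear f'"
    by (rule has_derivative_linear)
  have "f' = (\<lambda>h. inner h (adjoint f' 1))"
    using adjoint_works[OF lin, of _ 1] by (auto simp: fun_eq_iff)
  with f' have "GDERIV f x :> adjoint f' 1"
    unfolding gderiv_def by simp
  then show ?thesis
    by (simp add: gradient_eqI)
qed

definition cont_diff :: "('a::real_inner \<Rightarrow> real) \<Rightarrow> bool" where
  "cont_diff f \<longleftrightarrow> (\<forall>x. f differentiable (at x)) \<and> continuous_on UNIV (gradient f)"

(* Properness in the sense of convex analysis; it applies to a real-valued function
   through its embedding into ereal, where it holds automatically. *)
definition proper_fun :: "('a \<Rightarrow> ereal) \<Rightarrow> bool" where
  "proper_fun f \<longleftrightarrow> (\<forall>x. f x \<noteq> - \<infinity>) \<and> (\<exists>x. f x \<noteq> \<infinity>)"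

(* Only the values of the curve on [0, \<infinity>) matter; at 0 the derivative is one-sided. *)
definition ode_solution :: "('a::real_normed_vector \<Rightarrow> 'a) \<Rightarrow> (real \<Rightarrow> 'a) \<Rightarrow> bool" where
  "ode_solution F y \<longleftrightarrow> (\<forall>t\<ge>0. (y has_vector_derivative F (y t)) (at t within {0..}))"

end

theory Submission
  imports Defs
begin

text \<open>
  The linear map \<open>M\<^sup>-\<^sup>1\<close> carries the vector field of the transformed system to that of the
  original one, so it carries solutions to solutions (\<open>ode_solution_linear_image\<close>).
  The dissipative part \<open>y\<^sub>\<star> - y\<close> is affine and transforms at once.  For the Hamiltonian part,
  the chain rule gives \<open>\<nabla>Hbar(y) = M\<^sup>-\<^sup>T \<nabla>H(M\<^sup>-\<^sup>1 y)\<close> (\<open>GDERIV_matrix_vector_compose\<close>), so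
  applying \<open>M\<^sup>-\<^sup>1 J\<close> leaves \<open>M\<^sup>-\<^sup>1 J M\<^sup>-\<^sup>T\<close> in front of \<open>\<nabla>H\<close>; this matrix is \<open>J\<close> because
  the inverse of a matrix preserving \<open>J\<close> preserves \<open>J\<close> too (\<open>matrix_inv_congruence\<close>).
\<close>

text \<open>
  The gradient represents the derivative through the inner product, so composing
  with \<open>A\<close> on the inside turns into applying the adjoint of \<open>A\<close> to the gradient.
\<close>
lemma GDERIV_matrix_vector_compose:
  fixes A :: "real ^ 'n ^ 'm" and f :: "real ^ 'm \<Rightarrow> real"
  assumes "GDERIV f (A *v x) :> D"
  shows "GDERIV (\<lambda>x. f (A *v x)) x :> transpose A *v D"
proof -
  have "((*v) A has_derivative (*v) A) (at x)"
    by (simp add: bounded_linear_imp_has_derivative)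
  moreover have "(f has_derivative (\<lambda>h. inner h D)) (at (A *v x))"
    using assms by (simp add: gderiv_def)
  ultimately have "((\<lambda>x. f (A *v x)) has_derivative (\<lambda>h. inner (A *v h) D)) (at x)"
    by (rule has_derivative_compose)
  moreover have "inner (A *v h) D = inner h (transpose A *v D)" for h
    by (metis dot_lmul_matrix inner_commute transpose_matrix_vector)
  ultimately show ?thesis
    by (simp add: gderiv_def)
qed

lemma matrix_inv_left_right:
  assumes "invertible M"
  shows "matrix_inv M ** M = mat 1" and "M ** matrix_inv M = mat 1"
  using someI_ex[OF assms[unfolded invertible_def]] by (simp_all add: matrix_inv_def)

lemma matrix_inv_congruence:
  fixes M J :: "real ^ 'n ^ 'n"
  assumes M: "invertible M" and cong: "M ** J ** transpose M = J"
  shows "matrix_inv M ** J ** transpose (matrix_inv M) = J"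
proof -
  let ?N = "matrix_inv M"
  have N: "?N ** M = mat 1"
    by (rule matrix_inv_left_right(1)[OF M])
  have NT: "transpose M ** transpose ?N = mat 1"
    by (metis N matrix_transpose_mul transpose_mat)
  have "?N ** J ** transpose ?N = ?N ** (M ** J ** transpose M) ** transpose ?N"
    by (simp only: cong)
  also have "\<dots> = (?N ** M) ** J ** (transpose M ** transpose ?N)"
    by (simp only: matrix_mul_assoc)
  also have "\<dots> = J"
    by (simp add: N NT)
  finally show ?thesis .
qed

lemma ode_solution_linear_image:
  assumes L: "bounded_linear L" and sol: "ode_solution F y"
    and conj: "\<And>x. G (L x) = L (F x)"
  shows "ode_solution G (\<lambda>t. L (y t))"
  using sol unfolding ode_solution_def conj
  by (blast intro: bounded_linear.has_vector_derivative[OF L])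

theorem mainTheorem3:
  fixes H Hbar :: "real ^ ('n::finite + 'n) \<Rightarrow> real"
    and M :: "real ^ ('n + 'n) ^ ('n + 'n)"
    and zstar ystar :: "real ^ ('n + 'n)"
    and y z :: "real \<Rightarrow> real ^ ('n + 'n)"
  assumes H_proper: "proper_fun (\<lambda>x. ereal (H x))"
    and H_closed: "closed (epigraph UNIV H)"
    and H_convex: "convex_on UNIV H"
    and H_C1: "cont_diff H"
    and zstar_unique_min: "\<And>x. is_arg_min H (\<lambda>_. True) x \<longleftrightarrow> x = zstar"
    and H_ge: "\<And>x. H x \<ge> H zstar"
    and H_min: "H zstar = 0"
    and M_nonsing: "invertible M"
    and M_symp: "M ** symp_J ** transpose M = symp_J"
    and Hbar_def: "Hbar = (\<lambda>x. H (matrix_inv M *v x))"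
    and ystar_def: "ystar = M *v zstar"
    and y_sol: "ode_solution (\<lambda>x. symp_J *v gradient Hbar x + ystar - x) y"
    and z_def: "z = (\<lambda>t. matrix_inv M *v y t)"
  shows "ode_solution (\<lambda>x. symp_J *v gradient H x + zstar - x) z
    \<and> z 0 = matrix_inv M *v y 0
    \<and> (\<forall>t\<ge>0. y t = M *v z t)
    \<and> (\<forall>t\<ge>0. Hbar (y t) = H (z t))"
proof -
  let ?N = "matrix_inv M"
  have NM: "?N ** M = mat 1" and MN: "M ** ?N = mat 1"
    using M_nonsing by (simp_all add: matrix_inv_left_right)
  have NJN: "?N ** symp_J ** transpose ?N = symp_J"
    by (rule matrix_inv_congruence[OF M_nonsing M_symp])
  have grad: "gradient Hbar x = transpose ?N *v gradient H (?N *v x)" for x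
  proof -
    have "GDERIV H (?N *v x) :> gradient H (?N *v x)"
      using H_C1 by (intro gderiv_gradient) (simp add: cont_diff_def)
    then show ?thesis
      unfolding Hbar_def by (intro gradient_eqI GDERIV_matrix_vector_compose)
  qed
  have field: "symp_J *v gradient H (?N *v x) + zstar - ?N *v x
      = ?N *v (symp_J *v gradient Hbar x + ystar - x)" for x
  proof -
    have "?N *v (symp_J *v gradient Hbar x) = symp_J *v gradient H (?N *v x)"
      by (simp only: grad matrix_vector_mul_assoc matrix_mul_assoc NJN)
    moreover have "?N *v ystar = zstar"
      by (simp add: ystar_def matrix_vector_mul_assoc NM)
    ultimately show ?thesis
      by (simp add: matrix_vector_right_distrib matrix_vector_mult_diff_distrib)
  qed
  have "ode_solution (\<lambda>x. symp_J *v gradient H x + zstar - x) z"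
    unfolding z_def by (rule ode_solution_linear_image[where L = "(*v) ?N", OF _ y_sol field]) simp
  moreover have "y t = M *v z t" for t
    by (simp add: z_def matrix_vector_mul_assoc MN)
  moreover have "z 0 = ?N *v y 0" and "Hbar (y t) = H (z t)" for t
    by (simp_all add: z_def Hbar_def)
  ultimately show ?thesis
    by blast
qed

end
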